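(* Fix $\alpha\in(0,1)$, and let $\alpha_0+\alpha_1=\alpha$, with $\alpha_0,\alpha_1>0$. Fix any integers $n\geq1$ and $m\geq 1$ with $$m\leq\frac{n(n-1)}{2\log(1/\alpha_0)}.$$ Then $$\hat{L}_\alpha^{\mathrm{pwc}}(\mathcal{F}_{\mathrm{pwc}}^{(m)},\mathcal{D}_n):=\alpha_1\cdot\hat{R}(\mathcal{F}_{\mathrm{pwc}}^{(n-1)},\mathcal{D}_n)$$ is a valid distribution-free lower bound on $R_P(\mathcal{F}_{\mathrm{pwc}}^{(m)})$; that is, for every probability distribution $P$ on $\mathbb{R}^d\times\mathbb{R}$, if $\mathcal{D}_n\sim P^n$ then $\mathbb{P}_P\{R_P(\mathcal{F}_{\mathrm{pwc}}^{(m)})\geq\alpha_1\hat{R}(\mathcal{F}_{\mathrm{pwc}}^{(n-1)},\mathcal{D}_n)\}\geq1-\alpha$.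
   Context: Data points are $(X_i,Y_i)\in\mathbb{R}^d\times\mathbb{R}$, $d\ge1$, and $\mathcal{D}_n=((X_1,Y_1),\dots,(X_n,Y_n))$. For a function $f:\mathbb{R}^d\to\mathbb{R}$ the loss is the squared loss $\ell(f,(x,y))=(f(x)-y)^2$. For a distribution $P$, $R_P(f)=\mathbb{E}_P[(f(X)-Y)^2]$, and for a class $\mathcal{F}$ of functions, $R_P(\mathcal{F})=\inf_{f\in\mathcal{F}}R_P(f)$. The empirical risk is $\hat{R}(f,\mathcal{D}_n)=\frac1n\sum_{i=1}^n(f(X_i)-Y_i)^2$, and $\hat{R}(\mathcal{F},\mathcal{D}_n)=\inf_{f\in\mathcal{F}}\hat{R}(f,\mathcal{D}_n)$. For an integer $m\geq1$, the class of piecewise constant functions with at most $m$ components is $\mathcal{F}_{\mathrm{pwc}}^{(m)}=\{f:\mathbb{R}^d\to\mathbb{R}\ :\ |\{f(x):x\in\mathbb{R}^d\}|\leq m\}$. $\mathbb{P}_P$ denotes probability when $\mathcal{D}_n\sim P^n$. Functions, infima and events are implicitly assumed measurable so that expectations and probabilities are defined. *)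

theory Defs
  imports "HOL-Probability.Probability"
begin

definition sq_loss :: "(real ^ 'd \<Rightarrow> real) \<Rightarrow> (real ^ 'd) \<times> real \<Rightarrow> real" where
  "sq_loss f z = (f (fst z) - snd z)\<^sup>2"

text \<open>The response need not have a second moment under \<open>P\<close>, so the risk is an extended
  nonnegative real; a Bochner integral would silently turn an infinite risk into 0.\<close>

definition risk :: "((real ^ 'd) \<times> real) measure \<Rightarrow> (real ^ 'd \<Rightarrow> real) \<Rightarrow> ennreal" where
  "risk P f = (\<integral>\<^sup>+ z. ennreal (sq_loss f z) \<partial>P)"

definition class_risk :: "((real ^ 'd) \<times> real) measure \<Rightarrow> (real ^ 'd \<Rightarrow> real) set \<Rightarrow> ennreal" where
  "class_risk P F = (INF f\<in>F. risk P f)"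

definition emp_risk :: "nat \<Rightarrow> (real ^ 'd \<Rightarrow> real) \<Rightarrow> (nat \<Rightarrow> (real ^ 'd) \<times> real) \<Rightarrow> real" where
  "emp_risk n f D = (1 / real n) * (\<Sum>i = 1..n. sq_loss f (D i))"

definition class_emp_risk ::
    "nat \<Rightarrow> (real ^ 'd \<Rightarrow> real) set \<Rightarrow> (nat \<Rightarrow> (real ^ 'd) \<times> real) \<Rightarrow> real" where
  "class_emp_risk n F D = (INF f\<in>F. emp_risk n f D)"

text \<open>Finiteness of the range is explicit because \<open>card\<close> of an infinite set is 0. Borel
  measurability is the usual implicit requirement that makes the risk of \<open>f\<close> meaningful.\<close>

definition pwc_class :: "nat \<Rightarrow> (real ^ 'd \<Rightarrow> real) set" where
  "pwc_class m = {f \<in> borel_measurable borel. finite (range f) \<and> card (range f) \<le> m}"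

end

theory Submission
  imports Defs
begin

text \<open>
  Fix one function \<open>f\<close> with at most \<open>m\<close> values. The labels \<open>f (X\<^sub>1), \<dots>, f (X\<^sub>n)\<close> are i.i.d. on a set
  of at most \<open>m\<close> elements, so by the birthday paradox they are pairwise distinct with probability
  at most \<open>exp (- n (n - 1) / (2 m))\<close> (\<open>birthday_bound\<close>), and the upper bound on \<open>m\<close> is exactly what
  makes this at most \<open>\<alpha>\<^sub>0\<close>. Whenever two labels coincide, the values of \<open>f\<close> on the sample are also
  attained by a function with at most \<open>n - 1\<close> values, so the best empirical risk over that class is
  at most the empirical risk of \<open>f\<close> (\<open>class_emp_risk_le_of_not_inj\<close>). The latter is nonnegative with
  mean \<open>risk P f\<close>, so by Markov's inequality \<open>\<alpha>\<^sub>1\<close> times it exceeds \<open>risk P f\<close> with probability at most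
  \<open>\<alpha>\<^sub>1\<close> (\<open>prob_mult_exceeds_mean_le\<close>). A union bound gives failure probability at most \<open>\<alpha>\<close> for the
  single risk \<open>risk P f\<close>.

  The claim is about the infimum of these risks, which need not be attained. It is the limit of a
  decreasing sequence of risks, so continuity of the probability from above transfers the bound
  (\<open>prob_le_Inf_ge\<close>).

  Two points need more work. The labels are not uniformly distributed, so the birthday bound rests
  on Maclaurin's inequality: for nonnegative weights with a given sum, the elementary symmetric
  polynomials are largest when the weights are equal (\<open>sum_injections_le\<close>). And the best empirical
  risk is an infimum over an uncountable class; it is a measurable function of the sample because
  rational values at the sample points suffice to approximate it (\<open>class_emp_risk_less_iff\<close>).
\<close>

section \<open>Maclaurin's inequality for sums over injections\<close>

text \<open>Bernoulli's inequality in homogeneous form, which also covers \<open>x = 0\<close>: the graph of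
  a power lies above its tangent at \<open>x\<close>.\<close>

lemma power_ge_tangent:
  fixes x y :: real
  assumes "0 \<le> x" "0 \<le> y"
  shows "x ^ Suc n + real (Suc n) * x ^ n * (y - x) \<le> y ^ Suc n"
proof (cases "x = 0")
  case True
  then show ?thesis using assms by (cases n) auto
next
  case False
  with assms have x: "0 < x" by simp
  have "1 + real (Suc n) * (y / x - 1) \<le> (1 + (y / x - 1)) ^ Suc n"
    using x assms by (intro Bernoulli_inequality) simp
  then have "x ^ Suc n * (1 + real (Suc n) * (y / x - 1)) \<le> x ^ Suc n * (y / x) ^ Suc n"
    using x by (intro mult_left_mono) auto
  also have "x ^ Suc n * (y / x) ^ Suc n = y ^ Suc n"
    using x by (simp add: power_divide)
  also have "x ^ Suc n * (1 + real (Suc n) * (y / x - 1)) = x ^ Suc n + real (Suc n) * x ^ n * (y - x)"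
    using x by (simp add: field_simps)
  finally show ?thesis .
qed

text \<open>One step of the induction behind Maclaurin's inequality. Think of \<open>k\<close> weights that all equal \<open>x\<close>
  and one further weight \<open>p\<close>: the left-hand side is their elementary symmetric polynomial of degree
  \<open>Suc n\<close>, the right-hand side its value once all \<open>Suc k\<close> weights are replaced by their mean. After
  division by the binomial coefficient the left-hand side is the tangent at \<open>x\<close>, evaluated at
  the mean.\<close>

lemma maclaurin_step:
  fixes x p :: real
  assumes "0 \<le> x" "0 \<le> p"
  shows "real (k choose Suc n) * x ^ Suc n + p * real (k choose n) * x ^ n
         \<le> real (Suc k choose Suc n) * ((real k * x + p) / real (Suc k)) ^ Suc n"
proof -
  define y where "y = (real k * x + p) / real (Suc k)"
  define b where "b = real (Suc k choose Suc n)"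
  have y: "0 \<le> y" "real (Suc k) * (y - x) = p - x"
    using assms unfolding y_def by (auto simp: field_simps)
  \<comment> \<open>The two binomial identities turn the coefficient of \<^term>\<open>p - x\<close> into the slope of the tangent.\<close>
  have sum: "real (k choose n) + real (k choose Suc n) = b"
    by (simp add: b_def)
  have absorb: "real (Suc k) * real (k choose n) = real (Suc n) * b"
    using Suc_times_binomial[of n k] unfolding b_def by (metis of_nat_mult)
  have "real (k choose Suc n) * x ^ Suc n + p * real (k choose n) * x ^ n
      = b * x ^ Suc n + real (k choose n) * x ^ n * (p - x)"
    unfolding sum[symmetric] by (simp add: algebra_simps)
  also have "\<dots> = b * x ^ Suc n + (real (Suc k) * real (k choose n)) * x ^ n * (y - x)"
    unfolding y(2)[symmetric] by (simp only: mult_ac)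
  also have "\<dots> = b * (x ^ Suc n + real (Suc n) * x ^ n * (y - x))"
    unfolding absorb by (simp add: algebra_simps)
  also have "\<dots> \<le> b * y ^ Suc n"
    using power_ge_tangent[OF assms(1) y(1)] by (intro mult_left_mono) (auto simp: b_def)
  finally show ?thesis unfolding b_def y_def .
qed

text \<open>The elementary symmetric polynomial of degree \<open>card I\<close> is represented, up to the factor
  \<open>fact (card I)\<close>, as a sum of products over these functions. In this form it is the probability
  that i.i.d. variables indexed by \<open>I\<close> are pairwise distinct. Extensionality makes the set finite.\<close>

definition injections :: "'i set \<Rightarrow> 'a set \<Rightarrow> ('i \<Rightarrow> 'a) set" where
  "injections I S = {c \<in> I \<rightarrow>\<^sub>E S. inj_on c I}"

lemma finite_injections: "finite I \<Longrightarrow> finite S \<Longrightarrow> finite (injections I S)"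
  unfolding injections_def by (rule finite_subset[OF _ finite_PiE]) auto

lemma injections_empty_index: "injections {} S = {\<lambda>_. undefined}"
  unfolding injections_def by auto

lemma injections_empty_target: "I \<noteq> {} \<Longrightarrow> injections I {} = {}"
  unfolding injections_def by auto

text \<open>An injection either misses the new point \<open>j\<close> or hits it at exactly one index \<open>a\<close>.\<close>

lemma injections_insert:
  assumes "j \<notin> S"
  shows "injections I (insert j S)
         = injections I S \<union> (\<Union>a\<in>I. (\<lambda>c. c(a := j)) ` injections (I - {a}) S)"
proof (intro equalityI subsetI)
  fix c assume c: "c \<in> injections I (insert j S)"
  show "c \<in> injections I S \<union> (\<Union>a\<in>I. (\<lambda>c. c(a := j)) ` injections (I - {a}) S)"
  proof (cases "\<exists>a\<in>I. c a = j")
    case True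
    then obtain a where a: "a \<in> I" "c a = j" by auto
    have "c(a := undefined) \<in> injections (I - {a}) S"
      using c a unfolding injections_def
      by (auto simp: inj_on_def PiE_iff extensional_def)
    moreover have "c = (c(a := undefined))(a := j)" using a by auto
    ultimately show ?thesis using a(1) by blast
  next
    case False
    then show ?thesis using c unfolding injections_def by (auto simp: PiE_iff)
  qed
next
  fix c assume "c \<in> injections I S \<union> (\<Union>a\<in>I. (\<lambda>c. c(a := j)) ` injections (I - {a}) S)"
  then consider "c \<in> injections I S"
    | a d where "a \<in> I" "d \<in> injections (I - {a}) S" "c = d(a := j)" by blast
  then show "c \<in> injections I (insert j S)"
  proof cases
    case 1
    then show ?thesis unfolding injections_def by (auto simp: PiE_iff)
  next
    case (2 a d)
    have "inj_on d (I - {a})" "j \<notin> d ` (I - {a})"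
      using 2(2) assms unfolding injections_def by (auto simp: PiE_iff)
    then have "inj_on c (insert a (I - {a}))"
      unfolding 2(3) by (auto simp: inj_on_def)
    then show ?thesis
      using 2 unfolding injections_def by (auto simp: PiE_iff insert_absorb extensional_def)
  qed
qed

text \<open>The recursion of the elementary symmetric polynomials when one variable is added: the
  injections that hit \<open>j\<close> contribute the factor \<open>p j\<close> and leave an injection on one index less.\<close>

lemma sum_injections_insert:
  fixes p :: "'a \<Rightarrow> real"
  assumes I: "finite I" and S: "finite S" and j: "j \<notin> S"
  shows "(\<Sum>c\<in>injections I (insert j S). \<Prod>i\<in>I. p (c i))
       = (\<Sum>c\<in>injections I S. \<Prod>i\<in>I. p (c i))
         + (\<Sum>a\<in>I. p j * (\<Sum>c\<in>injections (I - {a}) S. \<Prod>i\<in>I - {a}. p (c i)))"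
proof -
  let ?U = "\<lambda>a. (\<lambda>c. c(a := j)) ` injections (I - {a}) S"
  have fin: "finite (injections K S)" if "K \<subseteq> I" for K
    using finite_injections finite_subset[OF that I] S by blast
  have hit: "c i = j \<longleftrightarrow> i = a" if "c \<in> ?U a" "a \<in> I" "i \<in> I" for c a i
    using that j unfolding injections_def by (auto simp: PiE_iff split: if_splits)
  have miss: "c i \<noteq> j" if "c \<in> injections I S" "i \<in> I" for c i
    using that j unfolding injections_def by (auto simp: PiE_iff)
  have inner: "(\<Sum>c\<in>?U a. \<Prod>i\<in>I. p (c i))
      = p j * (\<Sum>c\<in>injections (I - {a}) S. \<Prod>i\<in>I - {a}. p (c i))" if a: "a \<in> I" for a
  proof -
    have "inj_on (\<lambda>c. c(a := j)) (injections (I - {a}) S)"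
    proof (rule inj_onI)
      fix c d assume c: "c \<in> injections (I - {a}) S" and d: "d \<in> injections (I - {a}) S"
        and eq: "c(a := j) = d(a := j)"
      have "c a = d a" using c d unfolding injections_def by (auto simp: PiE_iff extensional_def)
      moreover have "c i = d i" if "i \<noteq> a" for i using fun_cong[OF eq, of i] that by simp
      ultimately show "c = d" by fastforce
    qed
    then have "(\<Sum>c\<in>?U a. \<Prod>i\<in>I. p (c i))
        = (\<Sum>c\<in>injections (I - {a}) S. \<Prod>i\<in>I. p ((c(a := j)) i))"
      by (simp add: sum.reindex)
    also have "\<dots> = (\<Sum>c\<in>injections (I - {a}) S. p j * (\<Prod>i\<in>I - {a}. p (c i)))"
    proof (intro sum.cong refl)
      fix c
      have "(\<Prod>i\<in>I - {a}. p ((c(a := j)) i)) = (\<Prod>i\<in>I - {a}. p (c i))"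
        by (rule prod.cong) auto
      then show "(\<Prod>i\<in>I. p ((c(a := j)) i)) = p j * (\<Prod>i\<in>I - {a}. p (c i))"
        using prod.remove[OF I a, of "\<lambda>i. p ((c(a := j)) i)"] by simp
    qed
    finally show ?thesis by (simp add: sum_distrib_left)
  qed
  have "injections I S \<inter> (\<Union>a\<in>I. ?U a) = {}"
    using hit miss by blast
  then have "(\<Sum>c\<in>injections I (insert j S). \<Prod>i\<in>I. p (c i))
      = (\<Sum>c\<in>injections I S. \<Prod>i\<in>I. p (c i)) + (\<Sum>c\<in>(\<Union>a\<in>I. ?U a). \<Prod>i\<in>I. p (c i))"
    unfolding injections_insert[OF j] using I fin
    by (intro sum.union_disjoint) auto
  also have "(\<Sum>c\<in>(\<Union>a\<in>I. ?U a). \<Prod>i\<in>I. p (c i)) = (\<Sum>a\<in>I. \<Sum>c\<in>?U a. \<Prod>i\<in>I. p (c i))"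
  proof (rule sum.UNION_disjoint)
    show "\<forall>a\<in>I. \<forall>b\<in>I. a \<noteq> b \<longrightarrow> ?U a \<inter> ?U b = {}"
      using hit by blast
  qed (use I fin in auto)
  finally show ?thesis using inner by simp
qed

text \<open>Maclaurin's inequality. Averaging the weights one at a time works because the
  induction hypothesis already replaces the weights on \<open>S\<close> by their mean, in both degrees that
  the recursion needs.\<close>

lemma sum_injections_le:
  fixes p :: "'a \<Rightarrow> real"
  assumes "finite S" "finite I" "\<And>s. s \<in> S \<Longrightarrow> 0 \<le> p s"
  shows "(\<Sum>c\<in>injections I S. \<Prod>i\<in>I. p (c i))
         \<le> fact (card I) * real (card S choose card I) * (sum p S / real (card S)) ^ card I"
  using assms
proof (induction S arbitrary: I rule: finite_induct)
  case empty
  show ?case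
    by (cases "I = {}") (auto simp: injections_empty_index injections_empty_target)
next
  case (insert j S)
  define k where "k = card S"
  define x where "x = sum p S / real k"
  have kx: "real k * x = sum p S"
    using insert.hyps by (cases "k = 0") (auto simp: x_def k_def)
  have x: "0 \<le> x" unfolding x_def using insert.prems by (auto intro!: divide_nonneg_nonneg sum_nonneg)
  have pj: "0 \<le> p j" using insert.prems by auto
  have IH: "(\<Sum>c\<in>injections J S. \<Prod>i\<in>J. p (c i)) \<le> fact (card J) * real (k choose card J) * x ^ card J"
    if "J \<subseteq> I" for J
    unfolding k_def x_def using insert.IH[of J] insert.prems finite_subset[OF that] by (simp add: k_def)
  show ?case
  proof (cases "card I")
    case 0
    then have "I = {}" using insert.prems by simp
    then show ?thesis by (simp add: injections_empty_index)
  next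
    case (Suc n)
    have "(\<Sum>c\<in>injections I (insert j S). \<Prod>i\<in>I. p (c i))
        \<le> fact (Suc n) * real (k choose Suc n) * x ^ Suc n
          + (\<Sum>a\<in>I. p j * (fact n * real (k choose n) * x ^ n))"
      unfolding sum_injections_insert[OF insert.prems(1) insert.hyps]
    proof (intro add_mono sum_mono mult_left_mono pj)
      show "(\<Sum>c\<in>injections I S. \<Prod>i\<in>I. p (c i)) \<le> fact (Suc n) * real (k choose Suc n) * x ^ Suc n"
        using IH[of I] Suc by simp
      fix a assume "a \<in> I"
      then have "card (I - {a}) = n" using Suc insert.prems by simp
      then show "(\<Sum>c\<in>injections (I - {a}) S. \<Prod>i\<in>I - {a}. p (c i)) \<le> fact n * real (k choose n) * x ^ n"
        using IH[of "I - {a}"] by auto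
    qed
    also have "\<dots> = fact (Suc n) * (real (k choose Suc n) * x ^ Suc n + p j * real (k choose n) * x ^ n)"
      using Suc by (simp add: algebra_simps)
    also have "\<dots> \<le> fact (Suc n) *
        (real (Suc k choose Suc n) * ((real k * x + p j) / real (Suc k)) ^ Suc n)"
      by (intro mult_left_mono maclaurin_step x pj) auto
    finally show ?thesis
      using insert.hyps Suc kx by (simp add: k_def add.commute mult.assoc del: binomial_Suc_Suc power_Suc)
  qed
qed

section \<open>The birthday paradox for arbitrary distributions\<close>

text \<open>The left-hand side is the probability that \<open>n\<close> uniform draws from \<open>k\<close> points are pairwise
  distinct, that is the product of the factors \<open>1 - i / k\<close>, each at most \<open>exp (- i / k)\<close>.\<close>

lemma fact_binomial_over_power_le_exp:
  assumes "0 < k"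
  shows "fact n * real (k choose n) * (1 / real k) ^ n \<le> exp (- (real n * (real n - 1) / (2 * real k)))"
proof (induction n)
  case (Suc n)
  show ?case
  proof (cases "n < k")
    case True
    have "(Suc n) * (k choose Suc n) = (k - n) * (k choose n)"
      using binomial_absorb_comp[of k n] binomial_absorption[of n k] by simp
    then have rec: "real (Suc n) * real (k choose Suc n) = (real k - real n) * real (k choose n)"
      using True by (metis less_imp_le of_nat_diff of_nat_mult)
    have "fact (Suc n) * real (k choose Suc n) * (1 / real k) ^ Suc n
        = fact n * (real (Suc n) * real (k choose Suc n)) * (1 / real k) ^ Suc n"
      by (simp add: algebra_simps)
    also have "\<dots> = (fact n * real (k choose n) * (1 / real k) ^ n) * (1 - real n / real k)"
      unfolding rec using assms by (simp add: field_simps)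
    also have "\<dots> \<le> exp (- (real n * (real n - 1) / (2 * real k))) * exp (- real n / real k)"
      using True exp_ge_add_one_self[of "- real n / real k"] by (intro mult_mono Suc.IH) auto
    also have "\<dots> = exp (- (real (Suc n) * (real (Suc n) - 1) / (2 * real k)))"
      using assms by (simp add: exp_add[symmetric] field_simps)
    finally show ?thesis .
  qed (simp add: binomial_eq_0)
qed simp

text \<open>Distinctness of the labels is a disjoint union over the injective label assignments, each of
  which has a product as its probability. The sum is a polynomial in the label probabilities that
  Maclaurin's inequality bounds by its value at the uniform distribution.\<close>

lemma birthday_bound:
  fixes h :: "'a \<Rightarrow> 'b"
  assumes "prob_space M" and h: "simple_function M h" and I: "finite I"
  shows "measure (PiM I (\<lambda>_. M)) {D \<in> space (PiM I (\<lambda>_. M)). inj_on (\<lambda>i. h (D i)) I}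
         \<le> exp (- (real (card I) * (real (card I) - 1) / (2 * real (card (h ` space M)))))"
proof -
  interpret M: prob_space M by fact
  interpret product_prob_space "\<lambda>_::'c. M" by (rule product_prob_spaceI) unfold_locales
  interpret finite_product_prob_space "\<lambda>_::'c. M" I by unfold_locales (rule I)
  define S where "S = h ` space M"
  define B where "B s = h -` {s} \<inter> space M" for s
  define p where "p s = M.prob (B s)" for s
  have S: "finite S" "S \<noteq> {}" using h M.not_empty unfolding S_def simple_function_def by auto
  have B: "B s \<in> sets M" for s unfolding B_def using simple_functionD(2)[OF h] by simp
  have "(\<Union>s\<in>S. B s) = space M" unfolding S_def B_def by auto
  then have "1 = M.prob (\<Union>s\<in>S. B s)" using M.prob_space by simp
  also have "\<dots> = sum p S" unfolding p_def
    by (rule M.finite_measure_finite_Union) (use S B in \<open>auto simp: disjoint_family_on_def B_def\<close>)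
  finally have p: "sum p S = 1" ..
  have "{D \<in> space (PiM I (\<lambda>_. M)). inj_on (\<lambda>i. h (D i)) I} = (\<Union>c\<in>injections I S. PiE I (\<lambda>i. B (c i)))"
  proof (intro equalityI subsetI)
    fix D assume D: "D \<in> {D \<in> space (PiM I (\<lambda>_. M)). inj_on (\<lambda>i. h (D i)) I}"
    then have "restrict (\<lambda>i. h (D i)) I \<in> injections I S"
      unfolding injections_def S_def by (auto simp: space_PiM PiE_iff inj_on_def)
    moreover have "D \<in> PiE I (\<lambda>i. B (restrict (\<lambda>i. h (D i)) I i))"
      using D unfolding B_def by (auto simp: space_PiM PiE_iff)
    ultimately show "D \<in> (\<Union>c\<in>injections I S. PiE I (\<lambda>i. B (c i)))" by blast
  next
    fix D assume "D \<in> (\<Union>c\<in>injections I S. PiE I (\<lambda>i. B (c i)))"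
    then show "D \<in> {D \<in> space (PiM I (\<lambda>_. M)). inj_on (\<lambda>i. h (D i)) I}"
      unfolding injections_def B_def by (auto simp: space_PiM PiE_iff inj_on_def)
  qed
  then have "prob {D \<in> space (PiM I (\<lambda>_. M)). inj_on (\<lambda>i. h (D i)) I}
      = prob (\<Union>c\<in>injections I S. PiE I (\<lambda>i. B (c i)))" by simp
  also have "\<dots> = (\<Sum>c\<in>injections I S. prob (PiE I (\<lambda>i. B (c i))))"
  proof (rule finite_measure_finite_Union)
    show "disjoint_family_on (\<lambda>c. PiE I (\<lambda>i. B (c i))) (injections I S)"
    proof (unfold disjoint_family_on_def, intro ballI impI equals0I)
      fix c d D assume c: "c \<in> injections I S" and d: "d \<in> injections I S" and "c \<noteq> d"
        and D: "D \<in> PiE I (\<lambda>i. B (c i)) \<inter> PiE I (\<lambda>i. B (d i))"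
      have "c i = d i" if "i \<in> I" for i
        using D that unfolding B_def by (auto simp: PiE_iff)
      then have "c = d"
        using c d unfolding injections_def by (auto intro: PiE_ext)
      then show False using \<open>c \<noteq> d\<close> by simp
    qed
  qed (use finite_injections I S B in \<open>auto intro!: sets_PiM_I_finite\<close>)
  also have "\<dots> = (\<Sum>c\<in>injections I S. \<Prod>i\<in>I. p (c i))"
    unfolding p_def using B by (intro sum.cong refl prob_times) auto
  also have "\<dots> \<le> fact (card I) * real (card S choose card I) * (1 / real (card S)) ^ card I"
    using sum_injections_le[OF S(1) I, of p] p by (simp add: p_def measure_nonneg)
  also have "\<dots> \<le> exp (- (real (card I) * (real (card I) - 1) / (2 * real (card S))))"
    using S by (intro fact_binomial_over_power_le_exp) (simp add: card_gt_0_iff)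
  finally show ?thesis unfolding S_def .
qed

section \<open>Markov's inequality and a limit of thresholds\<close>

text \<open>Markov's inequality for \<open>u\<close>, with its mean divided by \<open>a\<close> as the threshold. The mean may be infinite, where the event is
  empty, or zero, where \<open>u\<close> vanishes almost everywhere; the strict inequality is what makes the
  bound hold in these two cases as well.\<close>

lemma (in prob_space) prob_mult_exceeds_mean_le:
  assumes u: "u \<in> borel_measurable M" "\<And>x. 0 \<le> u x" and a: "0 < a"
  shows "prob {x \<in> space M. (\<integral>\<^sup>+ y. ennreal (u y) \<partial>M) < ennreal (a * u x)} \<le> a"
proof (cases "\<integral>\<^sup>+ y. ennreal (u y) \<partial>M")
  case top
  then show ?thesis using a by simp
next
  case (real r)
  show ?thesis
  proof (cases "r = 0")
    case True
    then have "AE x in M. u x = 0"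
      using real u by (auto simp: nn_integral_0_iff_AE)
    then have "AE x in M. \<not> (\<integral>\<^sup>+ y. ennreal (u y) \<partial>M) < ennreal (a * u x)"
      by eventually_elim (simp add: real True)
    then have "emeasure M {x \<in> space M. (\<integral>\<^sup>+ y. ennreal (u y) \<partial>M) < ennreal (a * u x)} = 0"
      by (intro emeasure_eq_0_AE)
    then show ?thesis using a by (simp add: measure_def)
  next
    case False
    with real have r: "0 < r" by simp
    have "emeasure M {x \<in> space M. (\<integral>\<^sup>+ y. ennreal (u y) \<partial>M) < ennreal (a * u x)}
        \<le> emeasure M {x \<in> space M. 1 \<le> ennreal (a / r) * ennreal (u x)}"
    proof (rule emeasure_mono)
      show "{x \<in> space M. (\<integral>\<^sup>+ y. ennreal (u y) \<partial>M) < ennreal (a * u x)}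
          \<subseteq> {x \<in> space M. 1 \<le> ennreal (a / r) * ennreal (u x)}"
        using r a u(2) unfolding real
        by (auto simp: ennreal_mult[symmetric] ennreal_less_iff field_simps simp flip: ennreal_1)
    qed (use u in measurable)
    also have "\<dots> \<le> ennreal (a / r) * (\<integral>\<^sup>+ x. ennreal (u x) * indicator (space M) x \<partial>M)"
      using u by (intro nn_integral_Markov_inequality) auto
    also have "(\<integral>\<^sup>+ x. ennreal (u x) * indicator (space M) x \<partial>M) = ennreal r"
      unfolding real(2)[symmetric] by (intro nn_integral_cong) simp
    also have "ennreal (a / r) * ennreal r = ennreal a"
      using r a by (simp flip: ennreal_mult)
    finally show ?thesis using a by (simp add: emeasure_eq_measure)
  qed
qed

text \<open>A bound that holds at each level of a set passes to its infimum, by continuity from above along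
  a decreasing sequence of levels.\<close>

lemma (in prob_space) prob_le_Inf_ge:
  fixes u :: "'a \<Rightarrow> ennreal"
  assumes u: "u \<in> borel_measurable M" and A: "A \<noteq> {}"
    and le: "\<And>r. r \<in> A \<Longrightarrow> b \<le> prob {x \<in> space M. u x \<le> r}"
  shows "b \<le> prob {x \<in> space M. u x \<le> Inf A}"
proof -
  obtain r :: "nat \<Rightarrow> ennreal" where r: "decseq r" "range r \<subseteq> A" "Inf A = (INF i. r i)"
    using ennreal_Inf_countable_INF[OF A] by blast
  have "(\<lambda>i. prob {x \<in> space M. u x \<le> r i}) \<longlonglongrightarrow> prob (\<Inter>i. {x \<in> space M. u x \<le> r i})"
  proof (rule finite_Lim_measure_decseq)
    show "range (\<lambda>i. {x \<in> space M. u x \<le> r i}) \<subseteq> sets M" using u by auto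
    show "decseq (\<lambda>i. {x \<in> space M. u x \<le> r i})"
      using r(1) unfolding decseq_def by (blast intro: order_trans)
  qed
  moreover have "(\<Inter>i. {x \<in> space M. u x \<le> r i}) = {x \<in> space M. u x \<le> Inf A}"
    unfolding r(3) by (auto simp: le_INF_iff)
  ultimately have "(\<lambda>i. prob {x \<in> space M. u x \<le> r i}) \<longlonglongrightarrow> prob {x \<in> space M. u x \<le> Inf A}"
    by simp
  then show ?thesis
    by (rule LIMSEQ_le_const) (use le r(2) in blast)
qed

section \<open>Empirical risk of piecewise constant functions\<close>

lemma sq_loss_nonneg: "0 \<le> sq_loss f z"
  unfolding sq_loss_def by simp

lemma emp_risk_nonneg: "0 \<le> emp_risk n f D"
  unfolding emp_risk_def by (simp add: sum_nonneg sq_loss_nonneg)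

lemma bdd_below_emp_risk: "bdd_below ((\<lambda>f. emp_risk n f D) ` F)"
  by (rule bdd_belowI2[where m = 0]) (rule emp_risk_nonneg)

lemma class_emp_risk_le:
  assumes "f \<in> F"
  shows "class_emp_risk n F D \<le> emp_risk n f D"
  unfolding class_emp_risk_def by (rule cINF_lower[OF bdd_below_emp_risk assms])

lemma emp_risk_cong:
  assumes "\<And>i. i \<in> {1..n} \<Longrightarrow> f (fst (D i)) = c i"
  shows "emp_risk n f D = 1 / real n * (\<Sum>i = 1..n. (c i - snd (D i))\<^sup>2)"
  unfolding emp_risk_def sq_loss_def using assms by simp

lemma pwc_class_nonempty:
  assumes "1 \<le> k"
  shows "pwc_class k \<noteq> {}"
proof -
  have "(\<lambda>_. 0) \<in> pwc_class k" using assms unfolding pwc_class_def by simp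
  then show ?thesis by blast
qed

lemma measurable_fst_snd_if_sets_borel:
  fixes P :: "((real ^ 'd) \<times> real) measure"
  assumes "sets P = sets borel"
  shows "fst \<in> borel_measurable P" "snd \<in> borel_measurable P"
proof -
  have "fst \<in> borel_measurable (borel :: ((real ^ 'd) \<times> real) measure)"
    "snd \<in> borel_measurable (borel :: ((real ^ 'd) \<times> real) measure)"
    by (intro borel_measurable_continuous_onI continuous_intros)+
  then show "fst \<in> borel_measurable P" "snd \<in> borel_measurable P"
    using assms by (simp_all cong: measurable_cong_sets)
qed

text \<open>Prescribed values at finitely many points extend to a measurable function without any
  new value: use the value at one of the points everywhere else.\<close>

lemma pwc_interpolation:
  fixes x :: "'i \<Rightarrow> real ^ 'd" and c :: "'i \<Rightarrow> real"
  assumes I: "finite I" "I \<noteq> {}"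
    and compat: "\<And>i j. i \<in> I \<Longrightarrow> j \<in> I \<Longrightarrow> x i = x j \<Longrightarrow> c i = c j"
    and card: "card (c ` I) \<le> k"
  shows "\<exists>g\<in>pwc_class k. \<forall>i\<in>I. g (x i) = c i"
proof -
  obtain i0 where i0: "i0 \<in> I" using I by auto
  \<comment> \<open>By consistency of the prescribed values it does not matter which index of a repeated point is chosen.\<close>
  define g where "g y = (if y \<in> x ` I then c (inv_into I x y) else c i0)" for y
  have g: "g (x i) = c i" if "i \<in> I" for i
  proof -
    have "x i \<in> x ` I" using that by simp
    then have "c (inv_into I x (x i)) = c i"
      using that by (intro compat inv_into_into f_inv_into_f)
    then show ?thesis unfolding g_def using that by simp
  qed
  have "g \<in> borel_measurable borel"
    by (rule measurable_discrete_difference[of "\<lambda>_. c i0" borel borel "x ` I"])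
       (use I in \<open>auto simp: g_def countable_finite\<close>)
  moreover have "range g \<subseteq> c ` I"
    unfolding g_def using i0 inv_into_into[of _ x I] by auto
  then have "finite (range g)" "card (range g) \<le> k"
    using I card card_mono[of "c ` I" "range g"] finite_subset[of "range g" "c ` I"] by auto
  ultimately show ?thesis using g unfolding pwc_class_def by blast
qed

text \<open>This is where the class with \<open>n - 1\<close> values enters: once two of the \<open>n\<close> labels coincide, a
  function with at most \<open>n - 1\<close> values agrees with \<open>f\<close> on the sample, however many values \<open>f\<close> has.\<close>

lemma class_emp_risk_le_of_not_inj:
  assumes "1 \<le> n" and "\<not> inj_on (\<lambda>i. f (fst (D i))) {1..n}"
  shows "class_emp_risk n (pwc_class (n - 1)) D \<le> emp_risk n f D"
proof -
  have "card ((\<lambda>i. f (fst (D i))) ` {1..n}) \<noteq> n"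
    using assms(2) eq_card_imp_inj_on[of "{1..n}" "\<lambda>i. f (fst (D i))"] by auto
  then have "card ((\<lambda>i. f (fst (D i))) ` {1..n}) \<le> n - 1"
    using card_image_le[of "{1..n}" "\<lambda>i. f (fst (D i))"] by simp
  then obtain g where g: "g \<in> pwc_class (n - 1)" "\<And>i. i \<in> {1..n} \<Longrightarrow> g (fst (D i)) = f (fst (D i))"
    using pwc_interpolation[of "{1..n}" "\<lambda>i. fst (D i)" "\<lambda>i. f (fst (D i))" "n - 1"] assms(1)
    by auto
  have "class_emp_risk n (pwc_class (n - 1)) D \<le> emp_risk n g D"
    by (rule class_emp_risk_le[OF g(1)])
  also have "\<dots> = emp_risk n f D"
    using g(2) unfolding emp_risk_def sq_loss_def by simp
  finally show ?thesis .
qed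

section \<open>Measurability and mean of the empirical risk\<close>

text \<open>Rounding is a function of the value alone, so applying it after \<open>f\<close> cannot increase the
  number of values of \<open>f\<close>.\<close>

lemma rational_approximants:
  obtains q :: "nat \<Rightarrow> real \<Rightarrow> real"
  where "\<And>N y. q N y \<in> \<rat>" and "\<And>y. (\<lambda>N. q N y) \<longlonglongrightarrow> y"
proof -
  define q :: "nat \<Rightarrow> real \<Rightarrow> real"
    where "q N y = (SOME r. r \<in> \<rat> \<and> y < r \<and> r < y + inverse (real (Suc N)))" for N y
  have "\<exists>r. r \<in> \<rat> \<and> y < r \<and> r < y + inverse (real (Suc N))" for N and y :: real
    using Rats_dense_in_real[of y "y + inverse (real (Suc N))"] by auto
  then have "q N y \<in> \<rat> \<and> y < q N y \<and> q N y < y + inverse (real (Suc N))" for N y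
    unfolding q_def by (rule someI_ex)
  then have q: "q N y \<in> \<rat>" "y < q N y" "q N y < y + inverse (real (Suc N))" for N y
    by auto
  show ?thesis
  proof
    fix y
    show "(\<lambda>N. q N y) \<longlonglongrightarrow> y"
      by (rule tendsto_sandwich[OF _ _ tendsto_const LIMSEQ_inverse_real_of_nat_add[of y]])
         (use q in \<open>auto intro!: always_eventually less_imp_le\<close>)
  qed (rule q(1))
qed

text \<open>Only the values at the sample points matter, and by continuity of the squared loss they can be
  taken rational. This reduces the infimum over functions to countably many value vectors \<open>c\<close>, each
  subject to a measurable condition on the sample: equal points must receive equal values.\<close>

lemma class_emp_risk_less_iff:
  fixes D :: "nat \<Rightarrow> (real ^ 'd) \<times> real"
  assumes n: "1 \<le> n" and k: "1 \<le> k"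
  shows "class_emp_risk n (pwc_class k) D < a \<longleftrightarrow>
    (\<exists>c\<in>{c \<in> {1..n} \<rightarrow>\<^sub>E \<rat>. card (c ` {1..n}) \<le> k}.
      (\<forall>i\<in>{1..n}. \<forall>j\<in>{1..n}. fst (D i) = fst (D j) \<longrightarrow> c i = c j) \<and>
      1 / real n * (\<Sum>i = 1..n. (c i - snd (D i))\<^sup>2) < a)" (is "?L \<longleftrightarrow> ?R")
proof
  assume ?L
  then obtain f where f: "f \<in> pwc_class k" "emp_risk n f D < a"
    unfolding class_emp_risk_def
    unfolding cINF_less_iff[OF pwc_class_nonempty[OF k] bdd_below_emp_risk] by blast
  obtain q :: "nat \<Rightarrow> real \<Rightarrow> real" where q: "\<And>N y. q N y \<in> \<rat>" "\<And>y. (\<lambda>N. q N y) \<longlonglongrightarrow> y"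
    using rational_approximants by blast
  have "(\<lambda>N. 1 / real n * (\<Sum>i = 1..n. (q N (f (fst (D i))) - snd (D i))\<^sup>2))
      \<longlonglongrightarrow> 1 / real n * (\<Sum>i = 1..n. (f (fst (D i)) - snd (D i))\<^sup>2)"
    by (intro tendsto_intros q)
  moreover have "1 / real n * (\<Sum>i = 1..n. (f (fst (D i)) - snd (D i))\<^sup>2) < a"
    using f(2) by (simp add: emp_risk_def sq_loss_def)
  ultimately have "eventually (\<lambda>N. 1 / real n * (\<Sum>i = 1..n. (q N (f (fst (D i))) - snd (D i))\<^sup>2) < a)
      sequentially"
    by (rule order_tendstoD)
  then obtain N where N: "1 / real n * (\<Sum>i = 1..n. (q N (f (fst (D i))) - snd (D i))\<^sup>2) < a"
    by (auto simp: eventually_sequentially)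
  define c where "c = (\<lambda>i\<in>{1..n}. q N (f (fst (D i))))"
  have "c ` {1..n} \<subseteq> q N ` range f" unfolding c_def by auto
  then have "card (c ` {1..n}) \<le> card (q N ` range f)"
    using f(1) unfolding pwc_class_def by (intro card_mono) auto
  also have "\<dots> \<le> card (range f)"
    using f(1) unfolding pwc_class_def by (intro card_image_le) auto
  also have "\<dots> \<le> k"
    using f(1) unfolding pwc_class_def by auto
  finally have "card (c ` {1..n}) \<le> k" .
  moreover have "c \<in> {1..n} \<rightarrow>\<^sub>E \<rat>" unfolding c_def using q(1) by auto
  moreover have "1 / real n * (\<Sum>i = 1..n. (c i - snd (D i))\<^sup>2) < a"
    using N unfolding c_def by simp
  moreover have "\<forall>i\<in>{1..n}. \<forall>j\<in>{1..n}. fst (D i) = fst (D j) \<longrightarrow> c i = c j"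
    unfolding c_def by simp
  ultimately show ?R by blast
next
  assume ?R
  then obtain c where c: "card (c ` {1..n}) \<le> k"
    "\<And>i j. i \<in> {1..n} \<Longrightarrow> j \<in> {1..n} \<Longrightarrow> fst (D i) = fst (D j) \<Longrightarrow> c i = c j"
    "1 / real n * (\<Sum>i = 1..n. (c i - snd (D i))\<^sup>2) < a" by blast
  have "\<exists>g\<in>pwc_class k. \<forall>i\<in>{1..n}. g (fst (D i)) = c i"
    by (rule pwc_interpolation[OF _ _ c(2,1)]) (use n in auto)
  then obtain g where g: "g \<in> pwc_class k" "\<And>i. i \<in> {1..n} \<Longrightarrow> g (fst (D i)) = c i"
    by blast
  show ?L
    using class_emp_risk_le[OF g(1), of n D] emp_risk_cong[of n g D c] g(2) c(3) by simp
qed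

lemma borel_measurable_class_emp_risk:
  fixes P :: "((real ^ 'd) \<times> real) measure"
  assumes P: "sets P = sets borel" and n: "1 \<le> n" and k: "1 \<le> k"
  shows "class_emp_risk n (pwc_class k) \<in> borel_measurable (PiM {1..n} (\<lambda>_. P))"
  unfolding borel_measurable_iff_less
proof
  fix a
  let ?M = "PiM {1..n} (\<lambda>_. P)"
  let ?C = "{c \<in> {1..n} \<rightarrow>\<^sub>E (\<rat> :: real set). card (c ` {1..n}) \<le> k}"
  let ?Q = "\<lambda>c D. (\<forall>i\<in>{1..n}. \<forall>j\<in>{1..n}. fst (D i) = fst (D j) \<longrightarrow> c i = c j) \<and>
      1 / real n * (\<Sum>i = 1..n. (c i - snd (D i))\<^sup>2) < a"
  have "countable ({1..n} \<rightarrow>\<^sub>E (\<rat> :: real set))"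
    by (intro countable_PiE countable_rat) auto
  then have C: "countable ?C" by (rule countable_subset[rotated]) auto
  have Q: "{D \<in> space ?M. ?Q c D} \<in> sets ?M" for c
  proof -
    have coord: "(\<lambda>D. fst (D i)) \<in> borel_measurable ?M" "(\<lambda>D. snd (D i)) \<in> borel_measurable ?M"
      if "i \<in> {1..n}" for i
      using that measurable_fst_snd_if_sets_borel[OF P]
      by (auto intro: measurable_compose[OF measurable_component_singleton])
    have eq: "{D \<in> space ?M. \<forall>i\<in>{1..n}. \<forall>j\<in>{1..n}. fst (D i) = fst (D j) \<longrightarrow> c i = c j} \<in> sets ?M"
    proof (intro sets.sets_Collect_finite_All finite_atLeastAtMost)
      fix i j assume "i \<in> {1..n}" "j \<in> {1..n}"
      then show "{D \<in> space ?M. fst (D i) = fst (D j) \<longrightarrow> c i = c j} \<in> sets ?M"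
        using sets.sets_Collect_imp[OF sets.sets_Collect_const measurable_equality_set[OF coord(1) coord(1)]]
        by blast
    qed
    have "(\<lambda>D. 1 / real n * (\<Sum>i = 1..n. (c i - snd (D i))\<^sup>2)) \<in> borel_measurable ?M"
      by (intro borel_measurable_times borel_measurable_sum borel_measurable_power borel_measurable_diff
          borel_measurable_const coord)
    then have "{D \<in> space ?M. 1 / real n * (\<Sum>i = 1..n. (c i - snd (D i))\<^sup>2) < a} \<in> sets ?M"
      by (intro borel_measurable_less borel_measurable_const)
    from sets.sets_Collect_conj[OF this eq] show ?thesis .
  qed
  have "{D \<in> space ?M. class_emp_risk n (pwc_class k) D < a} = (\<Union>c\<in>?C. {D \<in> space ?M. ?Q c D})"
    by (subst class_emp_risk_less_iff[OF n k]) blast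
  also have "\<dots> \<in> sets ?M" using C Q by (intro sets.countable_UN') auto
  finally show "{D \<in> space ?M. class_emp_risk n (pwc_class k) D < a} \<in> sets ?M" .
qed

lemma borel_measurable_sq_loss:
  fixes P :: "((real ^ 'd) \<times> real) measure"
  assumes P: "sets P = sets borel" and f: "f \<in> borel_measurable borel"
  shows "sq_loss f \<in> borel_measurable P"
proof -
  note [measurable] = measurable_fst_snd_if_sets_borel[OF P] f
  show ?thesis unfolding sq_loss_def by measurable
qed

lemma borel_measurable_emp_risk:
  fixes P :: "((real ^ 'd) \<times> real) measure"
  assumes P: "sets P = sets borel" and f: "f \<in> borel_measurable borel"
  shows "emp_risk n f \<in> borel_measurable (PiM {1..n} (\<lambda>_. P))"
proof -
  have "(\<lambda>D. sq_loss f (D i)) \<in> borel_measurable (PiM {1..n} (\<lambda>_. P))" if "i \<in> {1..n}" for i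
    by (rule measurable_compose[OF measurable_component_singleton[OF that] borel_measurable_sq_loss[OF P f]])
  then show ?thesis unfolding emp_risk_def by measurable
qed

lemma nn_integral_emp_risk:
  fixes P :: "((real ^ 'd) \<times> real) measure"
  assumes P: "prob_space P" "sets P = sets borel" and f: "f \<in> borel_measurable borel" and n: "1 \<le> n"
  shows "(\<integral>\<^sup>+ D. ennreal (emp_risk n f D) \<partial>PiM {1..n} (\<lambda>_. P)) = risk P f"
proof -
  let ?M = "PiM {1..n} (\<lambda>_. P)"
  have loss: "sq_loss f \<in> borel_measurable P"
    by (rule borel_measurable_sq_loss[OF P(2) f])
  have meas: "(\<lambda>D. ennreal (sq_loss f (D i))) \<in> borel_measurable ?M" if "i \<in> {1..n}" for i
    using measurable_compose[OF measurable_component_singleton[OF that] loss] by measurable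
  have marginal: "(\<integral>\<^sup>+ D. ennreal (sq_loss f (D i)) \<partial>?M) = risk P f" if i: "i \<in> {1..n}" for i
  proof -
    have "risk P f = (\<integral>\<^sup>+ z. ennreal (sq_loss f z) \<partial>distr ?M P (\<lambda>D. D i))"
      unfolding risk_def by (subst distr_PiM_component) (use P i in auto)
    also have "\<dots> = (\<integral>\<^sup>+ D. ennreal (sq_loss f (D i)) \<partial>?M)"
      using loss i by (intro nn_integral_distr) auto
    finally show ?thesis ..
  qed
  have "ennreal (emp_risk n f D) = ennreal (1 / real n) * (\<Sum>i = 1..n. ennreal (sq_loss f (D i)))" for D
    unfolding emp_risk_def by (subst ennreal_mult) (auto simp: sum_nonneg sq_loss_nonneg sum_ennreal)
  then have "(\<integral>\<^sup>+ D. ennreal (emp_risk n f D) \<partial>?M)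
      = (\<integral>\<^sup>+ D. ennreal (1 / real n) * (\<Sum>i = 1..n. ennreal (sq_loss f (D i))) \<partial>?M)"
    by simp
  also have "\<dots> = ennreal (1 / real n) * (\<Sum>i = 1..n. \<integral>\<^sup>+ D. ennreal (sq_loss f (D i)) \<partial>?M)"
    using meas by (simp only: nn_integral_cmult[OF borel_measurable_sum] nn_integral_sum)
  also have "\<dots> = ennreal (1 / real n) * (ennreal (real n) * risk P f)"
    using marginal by (simp add: ennreal_of_nat_eq_real_of_nat)
  also have "\<dots> = risk P f"
    using n by (simp add: mult.assoc[symmetric] ennreal_mult[symmetric])
  finally show ?thesis .
qed
section \<open>The lower bound\<close>

text \<open>The union bound for one function \<open>f\<close>: the lower bound can exceed the risk of \<open>f\<close> only if the labels
  \<open>f (X\<^sub>i)\<close> are pairwise distinct or \<open>\<alpha>\<^sub>1\<close> times the empirical risk of \<open>f\<close> exceeds its mean.\<close>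

lemma prob_class_emp_risk_exceeds_le:
  fixes P :: "((real ^ 'd) \<times> real) measure"
  assumes P: "prob_space P" "sets P = sets borel"
    and n: "2 \<le> n" and f: "f \<in> pwc_class m" and \<alpha>\<^sub>1: "0 < \<alpha>\<^sub>1"
  shows "\<P>(D in PiM {1..n} (\<lambda>_. P). risk P f < ennreal (\<alpha>\<^sub>1 * class_emp_risk n (pwc_class (n - 1)) D))
         \<le> exp (- (real n * (real n - 1) / (2 * real m))) + \<alpha>\<^sub>1"
proof -
  let ?M = "PiM {1..n} (\<lambda>_. P)"
  interpret prob_space ?M by (rule prob_space_PiM) (rule P)
  let ?C = "class_emp_risk n (pwc_class (n - 1)) :: (nat \<Rightarrow> (real ^ 'd) \<times> real) \<Rightarrow> real"
  let ?inj = "{D \<in> space ?M. inj_on (\<lambda>i. (f \<circ> fst) (D i)) {1..n}}"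
  let ?big = "{D \<in> space ?M. risk P f < ennreal (\<alpha>\<^sub>1 * emp_risk n f D)}"
  have f': "f \<in> borel_measurable borel" "finite (range f)" "card (range f) \<le> m"
    using f unfolding pwc_class_def by auto
  have emp: "emp_risk n f \<in> borel_measurable ?M"
    by (rule borel_measurable_emp_risk[OF P(2) f'(1)])
  have space_P: "space P = UNIV" using sets_eq_imp_space_eq[OF P(2)] by simp
  have range: "(f \<circ> fst) ` space P = range f"
    unfolding space_P image_comp[symmetric] by simp
  have "f \<circ> fst \<in> borel_measurable P"
    by (rule measurable_comp[OF measurable_fst_snd_if_sets_borel(1)[OF P(2)] f'(1)])
  then have simple: "simple_function P (f \<circ> fst)"
    using f'(2) range by (intro simple_function_borel_measurable) auto
  have inj_set: "?inj \<in> sets ?M"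
  proof -
    have coord: "(\<lambda>D. f (fst (D i))) \<in> borel_measurable ?M" if "i \<in> {1..n}" for i
      using measurable_compose[OF measurable_component_singleton[OF that] \<open>f \<circ> fst \<in> borel_measurable P\<close>]
      by (simp add: comp_def)
    have "{D \<in> space ?M. \<forall>i\<in>{1..n}. \<forall>j\<in>{1..n}. f (fst (D i)) = f (fst (D j)) \<longrightarrow> i = j} \<in> sets ?M"
    proof (intro sets.sets_Collect_finite_All finite_atLeastAtMost)
      fix i j assume "i \<in> {1..n}" "j \<in> {1..n}"
      then show "{D \<in> space ?M. f (fst (D i)) = f (fst (D j)) \<longrightarrow> i = j} \<in> sets ?M"
        using sets.sets_Collect_imp[OF sets.sets_Collect_const measurable_equality_set[OF coord coord]]
        by blast
    qed
    then show ?thesis by (simp add: inj_on_def)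
  qed
  have mean: "(\<integral>\<^sup>+ D. ennreal (emp_risk n f D) \<partial>?M) = risk P f"
    using n by (intro nn_integral_emp_risk[OF P f'(1)]) simp
  have big_set: "?big \<in> sets ?M" using emp by measurable
  have "{D \<in> space ?M. risk P f < ennreal (\<alpha>\<^sub>1 * ?C D)} \<subseteq> ?inj \<union> ?big"
  proof
    fix D assume D: "D \<in> {D \<in> space ?M. risk P f < ennreal (\<alpha>\<^sub>1 * ?C D)}"
    show "D \<in> ?inj \<union> ?big"
    proof (cases "inj_on (\<lambda>i. f (fst (D i))) {1..n}")
      case False
      then have "?C D \<le> emp_risk n f D"
        using n by (intro class_emp_risk_le_of_not_inj) auto
      then have "ennreal (\<alpha>\<^sub>1 * ?C D) \<le> ennreal (\<alpha>\<^sub>1 * emp_risk n f D)"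
        using \<alpha>\<^sub>1 by (intro ennreal_leI mult_left_mono) auto
      then show ?thesis using D by auto
    qed (use D in auto)
  qed
  then have "prob {D \<in> space ?M. risk P f < ennreal (\<alpha>\<^sub>1 * ?C D)} \<le> prob (?inj \<union> ?big)"
    using inj_set big_set by (intro finite_measure_mono) auto
  also have "\<dots> \<le> prob ?inj + prob ?big"
    by (rule measure_Un_le[OF inj_set big_set])
  also have "prob ?big \<le> \<alpha>\<^sub>1"
    using prob_mult_exceeds_mean_le[OF emp emp_risk_nonneg \<alpha>\<^sub>1] unfolding mean .
  also have "prob ?inj \<le> exp (- (real n * (real n - 1) / (2 * real (card (range f)))))"
    using birthday_bound[OF P(1) simple, of "{1..n}"] range by simp
  also have "\<dots> \<le> exp (- (real n * (real n - 1) / (2 * real m)))"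
  proof -
    have "0 < card (range f)" using f'(2) by (simp add: card_gt_0_iff)
    then have "real n * (real n - 1) / (2 * real m) \<le> real n * (real n - 1) / (2 * real (card (range f)))"
      using n f'(3) by (intro divide_left_mono) auto
    then show ?thesis by simp
  qed
  finally show ?thesis by simp
qed

theorem theorem6:
  fixes \<alpha> \<alpha>\<^sub>0 \<alpha>\<^sub>1 :: real
    and n m :: nat
    and P :: "((real ^ 'd) \<times> real) measure"
  assumes "0 < \<alpha>" and "\<alpha> < 1"
    and "\<alpha>\<^sub>0 + \<alpha>\<^sub>1 = \<alpha>" and "0 < \<alpha>\<^sub>0" and "0 < \<alpha>\<^sub>1"
    and "1 \<le> n" and "1 \<le> m"
    and "real m \<le> real n * (real n - 1) / (2 * ln (1 / \<alpha>\<^sub>0))"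
    and "prob_space P" and "sets P = sets borel"
  shows "\<P>(D in PiM {1..n} (\<lambda>_. P).
           class_risk P (pwc_class m) \<ge> ennreal (\<alpha>\<^sub>1 * class_emp_risk n (pwc_class (n - 1)) D))
         \<ge> 1 - \<alpha>"
proof -
  let ?M = "PiM {1..n} (\<lambda>_. P)"
  let ?u = "\<lambda>D. ennreal (\<alpha>\<^sub>1 * class_emp_risk n (pwc_class (n - 1)) D)"
  interpret prob_space ?M by (rule prob_space_PiM) (rule assms(9))
  have log: "0 < ln (1 / \<alpha>\<^sub>0)"
    using assms(2-5) by (intro ln_gt_zero) (simp add: field_simps)
  \<comment> \<open>For \<^term>\<open>n = (1::nat)\<close> the bound on \<^term>\<open>m\<close> would force \<^term>\<open>m = (0::nat)\<close>. Hence the class with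
    \<^term>\<open>n - 1\<close> values is nonempty and its infimum is meaningful.\<close>
  have "n \<noteq> 1"
    using assms(7,8) by auto
  then have n: "2 \<le> n" using assms(6) by simp
  have m: "0 < real m" using assms(7) by simp
  have "ln (1 / \<alpha>\<^sub>0) \<le> real n * (real n - 1) / (2 * real m)"
    using assms(8) log m by (simp add: field_simps)
  then have "exp (- (real n * (real n - 1) / (2 * real m))) \<le> exp (- ln (1 / \<alpha>\<^sub>0))"
    by simp
  also have "\<dots> = \<alpha>\<^sub>0" using assms(4) by (simp add: ln_div)
  finally have exp_le: "exp (- (real n * (real n - 1) / (2 * real m))) \<le> \<alpha>\<^sub>0" .
  have u: "?u \<in> borel_measurable ?M"
    using borel_measurable_class_emp_risk[OF assms(10), of n "n - 1"] n by simp
  have each: "1 - \<alpha> \<le> prob {D \<in> space ?M. ?u D \<le> risk P f}" if f: "f \<in> pwc_class m" for f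
  proof -
    have "prob {D \<in> space ?M. risk P f < ?u D} \<le> \<alpha>"
      using prob_class_emp_risk_exceeds_le[OF assms(9,10) n f assms(5)] exp_le assms(3) by linarith
    moreover have "{D \<in> space ?M. ?u D \<le> risk P f} = space ?M - {D \<in> space ?M. risk P f < ?u D}"
      by (auto simp: not_less)
    moreover have "{D \<in> space ?M. risk P f < ?u D} \<in> sets ?M"
      by (intro borel_measurable_less borel_measurable_const u)
    ultimately show ?thesis using prob_compl by simp
  qed
  have "1 - \<alpha> \<le> prob {D \<in> space ?M. ?u D \<le> Inf (risk P ` pwc_class m)}"
    by (rule prob_le_Inf_ge[OF u]) (use pwc_class_nonempty[OF assms(7)] each in auto)
  then show ?thesis unfolding class_risk_def .
qed

end
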